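(* Let $n\geq 2$ be an integer, let $c\in\mathbb{R}$, and let $f:\mathbb{R}\to\mathbb{R}$ be a function that is $n-1$ times Peano differentiable at $c$. Each of the following conditions (according to the parity of $n$) is sufficient for $f$ to be $n$ times Peano differentiable at $c$: (1) For $n$ odd: for every integer $k$ with $\tfrac{n+1}{2}\leq k\leq n-1$, the limit $\lim_{h\to 0} D_k(h)(f)/h^n$ exists, where $D_k(h)$ is a difference centered at $c$, of order at least $n$, one node of which is $k$ and whose other nodes all belong to the set $\{-\tfrac{n-1}{2},-\tfrac{n-1}{2}+1,\ldots,-1,0,1,\ldots,k-2,k-1\}$. (2) For $n$ even: for every integer $k$ with $\tfrac{n}{2}\leq k\leq n$, the limit $\lim_{h\to 0} D_k(h)(f)/h^n$ exists, where $D_k(h)$ is a difference centered at $c$, of order at least $n$, one node of which is $k$ and whose other nodes all belong to the set $\{-\tfrac{n}{2},-\tfrac{n}{2}+1,\ldots,-1,0,1,\ldots,k-2,k-1\}$.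
   Context: A difference centered at $c\in\mathbb{R}$ is an expression $D(h)(f)=\sum_{i=0}^m a_i f(c+b_i h)$, for functions $f:\mathbb{R}\to\mathbb{R}$ and real $h$, where the $a_i$ are non-zero real numbers (the coefficients) and the $b_i$ are distinct real numbers (the nodes). The difference has order $p$ if $D(1)(x^j)=0$ for $j=0,1,\ldots,p-1$ and $D(1)(x^p)\neq 0$; this does not depend on $c$, and is equivalent to $\sum_i a_i b_i^j=0$ for $0\le j\le p-1$ and $\sum_i a_i b_i^p\neq 0$ (with the convention $0^0=1$). A function $f$ is $r$ times Peano differentiable at $c$ if there is a polynomial $p$ such that $f(c+h)-p(c+h)=o(h^r)$, i.e. $\lim_{h\to0}\frac{f(c+h)-p(c+h)}{h^r}=0$. "The limit exists" means it exists as a finite real number. *)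

theory Defs
  imports Complex_Main "HOL-Computational_Algebra.Polynomial"
begin

text \<open>
  A difference with coefficients \<open>a 0, \<dots>, a m\<close> and nodes \<open>b 0, \<dots>, b m\<close>; the values of
  \<open>a\<close> and \<open>b\<close> beyond index \<open>m\<close> are irrelevant.
\<close>

definition is_difference :: "nat \<Rightarrow> (nat \<Rightarrow> real) \<Rightarrow> (nat \<Rightarrow> real) \<Rightarrow> bool" where
  "is_difference m a b \<longleftrightarrow> (\<forall>i\<le>m. a i \<noteq> 0) \<and> inj_on b {..m}"

definition difference ::
    "nat \<Rightarrow> (nat \<Rightarrow> real) \<Rightarrow> (nat \<Rightarrow> real) \<Rightarrow> real \<Rightarrow> real \<Rightarrow> (real \<Rightarrow> real) \<Rightarrow> real" where
  "difference m a b c h f = (\<Sum>i\<le>m. a i * f (c + b i * h))"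

definition nodes :: "nat \<Rightarrow> (nat \<Rightarrow> real) \<Rightarrow> real set" where
  "nodes m b = b ` {..m}"

definition has_order ::
    "nat \<Rightarrow> (nat \<Rightarrow> real) \<Rightarrow> (nat \<Rightarrow> real) \<Rightarrow> real \<Rightarrow> nat \<Rightarrow> bool" where
  "has_order m a b c p \<longleftrightarrow>
     (\<forall>j<p. difference m a b c 1 (\<lambda>x. x ^ j) = 0) \<and> difference m a b c 1 (\<lambda>x. x ^ p) \<noteq> 0"

text \<open>
  The limit is a punctured one, so the value \<open>f c\<close> is not constrained.
  No bound is put on the degree of the polynomial; terms of degree above \<open>r\<close> in \<open>x - c\<close> do not
  affect the limit.
\<close>

definition peano_differentiable :: "nat \<Rightarrow> (real \<Rightarrow> real) \<Rightarrow> real \<Rightarrow> bool" where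
  "peano_differentiable r f c \<longleftrightarrow>
     (\<exists>p :: real poly. ((\<lambda>h. (f (c + h) - poly p (c + h)) / h ^ r) \<longlongrightarrow> 0) (at 0))"

end

theory Submission
  imports Defs
begin

text \<open>
  Subtracting the Taylor polynomial of degree below \<open>n\<close> from \<open>f\<close> leaves a function \<open>g\<close> with
  \<open>g h = o(h ^ (n - 1))\<close>, and the task is to show that \<open>g h / h ^ n\<close> converges as \<open>h \<rightarrow> 0\<close>. Call
  a function of \<open>h\<close> negligible if its quotient by \<open>h ^ n\<close> converges. A difference of order at
  least \<open>n\<close> annihilates polynomials of degree below \<open>n\<close>, so its value at \<open>f\<close> is its value at \<open>g\<close>.

  Put \<open>q = n div 2\<close>. In both parities the index \<open>k\<close> runs through \<open>n - q, \<dots>, 2 q\<close> and the other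
  nodes of the \<open>k\<close>-th difference lie in \<open>{- q..k - 1}\<close>. For each \<open>h\<close> let \<open>P h\<close> be the polynomial
  of degree below \<open>n\<close> that takes the value \<open>g (j h)\<close> at the \<open>n\<close> integers \<open>j\<close> with
  \<open>- q \<le> j < n - q\<close>, and let \<open>E h x = g (x h) - P h x\<close> be the interpolation error. The \<open>k\<close>-th
  difference annihilates \<open>P h\<close>, so its value at \<open>g\<close> is a combination of the errors at its nodes.
  Since its coefficient at \<open>k\<close> is non-zero, induction on \<open>k\<close> shows that the error at every
  integer of \<open>{- q..2 q}\<close> is negligible. Replacing \<open>h\<close> by \<open>- h\<close> gives the same for
  \<open>{- 2 q..2 q}\<close> (lemma \<open>interpolation_error_power_limit\<close>).

  This range contains the doubles of all interpolation nodes. Therefore \<open>P (2 h) x\<close> and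
  \<open>P h (2 x)\<close>, which both approximate \<open>g (2 x h)\<close>, agree at the interpolation nodes \<open>x\<close> up to a
  negligible error, and by comparing coefficients, the \<open>j\<close>-th coefficient
  \<open>p h\<close> of \<open>P h\<close> is such that \<open>p (2 h) - 2 ^ j * p h\<close> is negligible. As \<open>j < n\<close> and
  \<open>p h = o(h ^ (n - 1))\<close>, iterating along \<open>h, h / 2, h / 4, \<dots>\<close> shows that \<open>p\<close> itself is
  negligible (lemma \<open>power_limit_of_dilation\<close>). Hence so is \<open>g h = P h 1 + E h 1\<close>.
\<close>

section \<open>Functions comparable to a power\<close>

text \<open>
  \<open>\<phi> h = L * h ^ n + o(h ^ n)\<close> for some real \<open>L\<close>, possibly zero, as \<open>h\<close> tends to zero
  from both sides.
\<close>

definition power_limit :: "nat \<Rightarrow> (real \<Rightarrow> real) \<Rightarrow> bool" where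
  "power_limit n \<phi> \<longleftrightarrow> (\<exists>L. ((\<lambda>h. \<phi> h / h ^ n) \<longlongrightarrow> L) (at 0))"

lemma power_limit_zero [simp]: "power_limit n (\<lambda>h. 0)"
  unfolding power_limit_def by auto

lemma power_limit_add:
  assumes "power_limit n \<phi>" "power_limit n \<psi>"
  shows "power_limit n (\<lambda>h. \<phi> h + \<psi> h)"
  using assms unfolding power_limit_def add_divide_distrib by - (elim exE, rule exI, erule (1) tendsto_add)

lemma power_limit_cmult:
  assumes "power_limit n \<phi>"
  shows "power_limit n (\<lambda>h. c * \<phi> h)"
  using assms unfolding power_limit_def times_divide_eq_right [symmetric]
  by - (elim exE, rule exI, erule tendsto_mult_left)

lemma power_limit_diff:
  assumes "power_limit n \<phi>" "power_limit n \<psi>"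
  shows "power_limit n (\<lambda>h. \<phi> h - \<psi> h)"
  using power_limit_add [OF assms(1) power_limit_cmult [OF assms(2), of "-1"]] by simp

lemma power_limit_sum:
  assumes "\<And>i. i \<in> A \<Longrightarrow> power_limit n (\<phi> i)"
  shows "power_limit n (\<lambda>h. \<Sum>i\<in>A. \<phi> i h)"
  using assms by (induction A rule: infinite_finite_induct) (auto intro: power_limit_add)

lemma filterlim_times_at_0:
  fixes b :: real
  assumes "b \<noteq> 0"
  shows "filterlim (\<lambda>h. b * h) (at 0) (at 0)"
proof (rule filterlim_atI)
  show "((\<lambda>h. b * h) \<longlongrightarrow> 0) (at 0)"
    by (intro tendsto_eq_intros) auto
  show "eventually (\<lambda>h. b * h \<noteq> 0) (at 0)"
    using assms by (auto simp: eventually_at_filter)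
qed

lemma tendsto_scaled_quotient:
  fixes b :: real
  assumes "((\<lambda>h. g h / h ^ r) \<longlongrightarrow> L) (at 0)" "b \<noteq> 0"
  shows "((\<lambda>h. g (b * h) / h ^ r) \<longlongrightarrow> b ^ r * L) (at 0)"
proof -
  have "((\<lambda>h. b ^ r * (g (b * h) / (b * h) ^ r)) \<longlongrightarrow> b ^ r * L) (at 0)"
    by (intro tendsto_mult_left filterlim_compose [OF assms(1) filterlim_times_at_0] assms(2))
  then show ?thesis
    using assms(2) by (simp add: power_mult_distrib)
qed

lemma power_limit_reflect:
  assumes "power_limit n \<phi>"
  shows "power_limit n (\<lambda>h. \<phi> (- h))"
  using assms tendsto_scaled_quotient [of \<phi> n _ "-1"] unfolding power_limit_def by auto

text \<open>
  The step from order \<open>n - 1\<close> to order \<open>n\<close>. The quotient \<open>v h = \<phi> h / h ^ n\<close> satisfies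
  \<open>v (2 h) = \<lambda> * v h + w h\<close> with \<open>w\<close> convergent and \<open>\<lambda> = 2 ^ j / 2 ^ n \<le> 1 / 2\<close>. After shifting
  \<open>v\<close> by a constant, \<open>w\<close> tends to zero. Unfolding this relation along \<open>h, h / 2, h / 4, \<dots>\<close>
  bounds \<open>v\<close> by twice the supremum of \<open>w\<close> near zero; the remainder vanishes because
  \<open>v h = o(1 / h)\<close> and \<open>\<lambda> \<le> 1 / 2\<close>.
\<close>

lemma power_limit_of_dilation:
  fixes \<phi> :: "real \<Rightarrow> real"
  assumes "j < n"
    and small: "((\<lambda>h. \<phi> h / h ^ (n - 1)) \<longlongrightarrow> 0) (at 0)"
    and dil: "power_limit n (\<lambda>h. \<phi> (2 * h) - 2 ^ j * \<phi> h)"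
  shows "power_limit n \<phi>"
proof -
  from dil obtain L where L: "((\<lambda>h. (\<phi> (2 * h) - 2 ^ j * \<phi> h) / h ^ n) \<longlongrightarrow> L) (at 0)"
    unfolding power_limit_def by auto
  have lam: "(2::real) * 2 ^ j \<le> 2 ^ n"
    using power_increasing [of "Suc j" n "2::real"] \<open>j < n\<close> by simp
  have pos: "(2::real) ^ n - 2 ^ j > 0"
    using lam zero_less_power [of "2::real" j] by linarith
  \<comment> \<open>The fixed point of the recursion with \<open>w\<close> replaced by its limit.\<close>
  define M where "M = L / (2 ^ n - 2 ^ j)"
  define v where "v h = \<phi> h / h ^ n - M" for h
  define w where "w h = v (2 * h) - 2 ^ j / 2 ^ n * v h" for h
  have w_eq: "w h = ((\<phi> (2 * h) - 2 ^ j * \<phi> h) / h ^ n - L) / 2 ^ n" if "h \<noteq> 0" for h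
  proof -
    have L_eq: "L = M * (2 ^ n - 2 ^ j)"
      using pos by (simp add: M_def)
    show ?thesis
      using that unfolding L_eq by (simp add: w_def v_def field_simps power_mult_distrib)
  qed
  have "((\<lambda>h. ((\<phi> (2 * h) - 2 ^ j * \<phi> h) / h ^ n - L) / 2 ^ n) \<longlongrightarrow> (L - L) / 2 ^ n) (at 0)"
    by (intro tendsto_intros L) auto
  then have w0: "(w \<longlongrightarrow> 0) (at 0)"
    using w_eq by (auto elim!: Lim_transform_eventually simp: eventually_at_filter)
  have hv0: "((\<lambda>h. h * v h) \<longlongrightarrow> 0) (at 0)"
  proof -
    have "((\<lambda>h. \<phi> h / h ^ (n - 1) - h * M) \<longlongrightarrow> 0 - 0 * M) (at 0)"
      by (intro tendsto_intros small)
    moreover have "\<phi> h / h ^ (n - 1) - h * M = h * v h" if "h \<noteq> 0" for h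
      using that \<open>j < n\<close> by (cases n) (auto simp: v_def field_simps)
    ultimately show ?thesis
      by (auto elim!: Lim_transform_eventually simp: eventually_at_filter)
  qed
  have "(v \<longlongrightarrow> 0) (at 0)"
  proof (rule tendstoI)
    fix e :: real
    assume "e > 0"
    then have "eventually (\<lambda>h. \<bar>w h\<bar> < e / 4) (at 0)"
      using tendstoD [OF w0, of "e / 4"] by simp
    then obtain d where "d > 0" and d: "\<And>h. h \<noteq> 0 \<Longrightarrow> \<bar>h\<bar> < d \<Longrightarrow> \<bar>w h\<bar> < e / 4"
      unfolding eventually_at by auto
    have bound: "\<bar>v h\<bar> \<le> (1 / 2) ^ N * \<bar>v (h / 2 ^ N)\<bar> + e / 2"
      if h: "h \<noteq> 0" "\<bar>h\<bar> < d" for h N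
      using h
    proof (induction N arbitrary: h)
      case 0
      then show ?case using \<open>e > 0\<close> by simp
    next
      case (Suc N)
      have h2: "\<bar>h / 2\<bar> < d"
        using Suc.prems by auto
      have "v h = w (h / 2) + 2 ^ j / 2 ^ n * v (h / 2)"
        by (simp add: w_def)
      also have "\<bar>\<dots>\<bar> \<le> \<bar>w (h / 2)\<bar> + 2 ^ j / 2 ^ n * \<bar>v (h / 2)\<bar>"
        by (rule order_trans [OF abs_triangle_ineq]) (simp add: abs_mult)
      also have "2 ^ j / 2 ^ n * \<bar>v (h / 2)\<bar> \<le> 1 / 2 * \<bar>v (h / 2)\<bar>"
        by (rule mult_right_mono) (use lam in \<open>simp_all add: field_simps\<close>)
      also have "\<bar>v (h / 2)\<bar> \<le> (1 / 2) ^ N * \<bar>v (h / 2 / 2 ^ N)\<bar> + e / 2"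
        by (rule Suc.IH) (use Suc.prems h2 in auto)
      finally have "\<bar>v h\<bar> \<le> \<bar>w (h / 2)\<bar> + 1 / 2 * ((1 / 2) ^ N * \<bar>v (h / 2 / 2 ^ N)\<bar> + e / 2)"
        by simp
      also have "\<dots> = (1 / 2) ^ Suc N * \<bar>v (h / 2 ^ Suc N)\<bar> + e / 4 + \<bar>w (h / 2)\<bar>"
        by (simp add: algebra_simps)
      also have "\<bar>w (h / 2)\<bar> \<le> e / 4"
        using d [of "h / 2"] h2 Suc.prems by simp
      finally show ?case
        by simp
    qed
    have le: "\<bar>v h\<bar> \<le> e / 2" if h: "h \<noteq> 0" "\<bar>h\<bar> < d" for h
    proof -
      have lim: "filterlim (\<lambda>N. h / 2 ^ N) (at 0) sequentially"
      proof (rule filterlim_atI)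
        show "(\<lambda>N. h / 2 ^ N) \<longlonglongrightarrow> 0"
          using tendsto_mult_left [OF LIMSEQ_power_zero [of "1 / 2 :: real"], of h]
          by (simp add: power_divide)
      qed (use h in auto)
      have "(\<lambda>N. \<bar>h / 2 ^ N * v (h / 2 ^ N)\<bar> / \<bar>h\<bar> + e / 2) \<longlonglongrightarrow> \<bar>0\<bar> / \<bar>h\<bar> + e / 2"
        by (intro tendsto_intros filterlim_compose [OF hv0 lim]) (use h in auto)
      moreover have "\<bar>h / 2 ^ N * v (h / 2 ^ N)\<bar> / \<bar>h\<bar> = (1 / 2) ^ N * \<bar>v (h / 2 ^ N)\<bar>" for N
        using h by (simp add: abs_mult power_divide)
      ultimately have "(\<lambda>N. (1 / 2) ^ N * \<bar>v (h / 2 ^ N)\<bar> + e / 2) \<longlonglongrightarrow> e / 2"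
        by simp
      then show ?thesis
        by (rule LIMSEQ_le_const) (use bound [OF h] in auto)
    qed
    have "dist (v h) 0 < e" if "h \<noteq> 0" "dist h 0 < d" for h
      using le [of h] that \<open>e > 0\<close> by simp
    then show "eventually (\<lambda>h. dist (v h) 0 < e) (at 0)"
      unfolding eventually_at using \<open>d > 0\<close> by blast
  qed
  then have "((\<lambda>h. v h + M) \<longlongrightarrow> 0 + M) (at 0)"
    by (intro tendsto_intros)
  then show ?thesis
    unfolding power_limit_def v_def by auto
qed

section \<open>Polynomial interpolation\<close>

text \<open>
  For a point \<open>x\<close> of a finite set \<open>K\<close>, the polynomial of degree below \<open>card K\<close> that is \<open>1\<close> at
  \<open>x\<close> and \<open>0\<close> at the other points of \<open>K\<close>.
\<close>

definition lagrange_basis :: "real set \<Rightarrow> real \<Rightarrow> real poly" where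
  "lagrange_basis K x = (\<Prod>y\<in>K - {x}. smult (1 / (x - y)) [:- y, 1:])"

lemma poly_lagrange_basis:
  assumes "finite K" "z \<in> K"
  shows "poly (lagrange_basis K x) z = (if z = x then 1 else 0)"
proof (cases "z = x")
  case True
  have "(\<Prod>y\<in>K - {x}. poly (smult (1 / (x - y)) [:- y, 1:]) x) = (\<Prod>y\<in>K - {x}. 1)"
    by (rule prod.cong) (auto simp flip: diff_divide_distrib)
  then show ?thesis
    using True by (simp add: lagrange_basis_def poly_prod)
next
  case False
  then have "\<exists>y\<in>K - {x}. poly (smult (1 / (x - y)) [:- y, 1:]) z = 0"
    using assms by (intro bexI [of _ z]) auto
  then have "(\<Prod>y\<in>K - {x}. poly (smult (1 / (x - y)) [:- y, 1:]) z) = 0"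
    using assms by (intro prod_zero) auto
  then show ?thesis
    using False by (simp only: lagrange_basis_def poly_prod if_False)
qed

lemma degree_lagrange_basis:
  assumes "finite K" "x \<in> K"
  shows "degree (lagrange_basis K x) < card K"
proof -
  have "degree (lagrange_basis K x)
      \<le> (\<Sum>y\<in>K - {x}. (degree \<circ> (\<lambda>y. smult (1 / (x - y)) [:- y, 1:])) y)"
    unfolding lagrange_basis_def using assms by (intro degree_prod_sum_le) auto
  also have "\<dots> \<le> (\<Sum>y\<in>K - {x}. 1)"
    by (rule sum_mono) simp
  also have "\<dots> < card K"
    using assms card_gt_0_iff [of K] by auto
  finally show ?thesis .
qed

text \<open>
  The polynomial of degree below \<open>card K\<close> that agrees with \<open>u\<close> on a finite non-empty set \<open>K\<close>.
\<close>

definition lagrange_interpolant :: "real set \<Rightarrow> (real \<Rightarrow> real) \<Rightarrow> real poly" where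
  "lagrange_interpolant K u = (\<Sum>x\<in>K. smult (u x) (lagrange_basis K x))"

lemma poly_lagrange_interpolant:
  assumes "finite K" "z \<in> K"
  shows "poly (lagrange_interpolant K u) z = u z"
proof -
  have "poly (lagrange_interpolant K u) z = (\<Sum>x\<in>K. if z = x then u x else 0)"
    unfolding lagrange_interpolant_def poly_sum
    by (rule sum.cong) (auto simp: poly_lagrange_basis [OF assms])
  then show ?thesis
    using assms by simp
qed

lemma degree_lagrange_interpolant:
  assumes "finite K" "K \<noteq> {}"
  shows "degree (lagrange_interpolant K u) < card K"
  unfolding lagrange_interpolant_def
proof (rule degree_sum_less)
  show "degree (smult (u x) (lagrange_basis K x)) < card K" if "x \<in> K" for x
    by (rule le_less_trans [OF degree_smult_le degree_lagrange_basis [OF assms(1) that]])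
qed (use assms in \<open>simp add: card_gt_0_iff\<close>)

lemma lagrange_interpolant_unique:
  assumes "finite K" "degree Q < card K"
  shows "Q = lagrange_interpolant K (poly Q)"
proof -
  have "K \<noteq> {}"
    using assms(2) by auto
  then show ?thesis
    using assms
    by (intro poly_eqI_degree [of K] degree_lagrange_interpolant)
       (simp_all add: poly_lagrange_interpolant)
qed

section \<open>Propagation of the interpolation error\<close>

text \<open>
  The coefficient of a difference at its node \<open>y\<close> is non-zero, so control of the difference
  and of the function at all other nodes gives control at \<open>y\<close>.
\<close>

lemma power_limit_at_node:
  fixes a b :: "nat \<Rightarrow> real" and e :: "real \<Rightarrow> real \<Rightarrow> real"
  assumes "is_difference m a b" "y \<in> nodes m b"
    and "power_limit n (\<lambda>h. \<Sum>i\<le>m. a i * e (b i) h)"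
    and "\<And>z. z \<in> nodes m b - {y} \<Longrightarrow> power_limit n (e z)"
  shows "power_limit n (e y)"
proof -
  obtain i where i: "i \<le> m" "b i = y"
    using assms(2) by (auto simp: nodes_def)
  have ai: "a i \<noteq> 0" and inj: "inj_on b {..m}"
    using assms(1) i by (auto simp: is_difference_def)
  have "power_limit n (e (b l))" if "l \<in> {..m} - {i}" for l
    using that i inj_onD [OF inj, of l i] by (intro assms(4)) (auto simp: nodes_def)
  then have "power_limit n (\<lambda>h. 1 / a i *
      ((\<Sum>l\<le>m. a l * e (b l) h) - (\<Sum>l\<in>{..m} - {i}. a l * e (b l) h)))"
    by (intro power_limit_cmult power_limit_diff assms(3) power_limit_sum)
  moreover have "(\<Sum>l\<le>m. a l * e (b l) h) = a i * e y h + (\<Sum>l\<in>{..m} - {i}. a l * e (b l) h)" for h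
    using i by (subst sum.remove [of _ i]) auto
  ultimately show ?thesis
    using ai by simp
qed

text \<open>
  Here \<open>P h\<close> is any family of polynomials of degree below \<open>n\<close> that interpolates \<open>g (j h)\<close> at the
  integers \<open>j\<close> with \<open>- q \<le> j < n - q\<close>.
\<close>

lemma interpolation_error_power_limit:
  fixes n :: nat and g :: "real \<Rightarrow> real" and P :: "real \<Rightarrow> real poly"
    and m :: "int \<Rightarrow> nat" and a b :: "int \<Rightarrow> nat \<Rightarrow> real"
  defines "q \<equiv> int (n div 2)"
  assumes deg: "\<And>h. degree (P h) < n"
    and interp: "\<And>h j. - q \<le> j \<Longrightarrow> j < int n - q \<Longrightarrow> poly (P h) (of_int j) = g (of_int j * h)"
    and diff: "\<And>k. int n - q \<le> k \<Longrightarrow> k \<le> 2 * q \<Longrightarrow> is_difference (m k) (a k) (b k)"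
    and annih: "\<And>k Q. int n - q \<le> k \<Longrightarrow> k \<le> 2 * q \<Longrightarrow> degree Q < n \<Longrightarrow>
                  (\<Sum>i\<le>m k. a k i * poly Q (b k i)) = 0"
    and node: "\<And>k. int n - q \<le> k \<Longrightarrow> k \<le> 2 * q \<Longrightarrow> of_int k \<in> nodes (m k) (b k)"
    and others: "\<And>k. int n - q \<le> k \<Longrightarrow> k \<le> 2 * q \<Longrightarrow>
                   nodes (m k) (b k) - {of_int k} \<subseteq> of_int ` {- q..k - 1}"
    and lim: "\<And>k. int n - q \<le> k \<Longrightarrow> k \<le> 2 * q \<Longrightarrow>
                power_limit n (\<lambda>h. \<Sum>i\<le>m k. a k i * g (b k i * h))"
    and j: "- 2 * q \<le> j" "j \<le> 2 * q"
  shows "power_limit n (\<lambda>h. g (of_int j * h) - poly (P h) (of_int j))"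
proof -
  define e where "e x h = g (x * h) - poly (P h) x" for x h
  have q: "int n - q - 1 \<le> q" "2 * q \<le> int n"
    by (auto simp: q_def)
  have right: "- q \<le> k \<Longrightarrow> k \<le> 2 * q \<Longrightarrow> power_limit n (e (of_int k))" for k
  proof (induction "nat (k + q)" arbitrary: k rule: less_induct)
    case less
    show ?case
    proof (cases "k < int n - q")
      case True
      then show ?thesis
        using less.prems by (simp add: e_def [abs_def] interp)
    next
      case False
      then have k: "int n - q \<le> k" "k \<le> 2 * q"
        using less.prems by auto
      show ?thesis
      proof (rule power_limit_at_node [OF diff [OF k] node [OF k]])
        show "power_limit n (\<lambda>h. \<Sum>i\<le>m k. a k i * e (b k i) h)"
          using lim [OF k] annih [OF k deg]
          by (simp add: e_def right_diff_distrib sum_subtractf)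
      next
        fix z
        assume "z \<in> nodes (m k) (b k) - {of_int k}"
        then obtain l where "z = of_int l" "- q \<le> l" "l \<le> k - 1"
          using others [OF k] by auto
        then show "power_limit n (e z)"
          using less by auto
      qed
    qed
  qed
  \<comment> \<open>The difference at \<open>- h\<close> is a difference at \<open>h\<close> whose nodes are reflected in the origin.\<close>
  have left: "k \<le> 2 * q \<Longrightarrow> - q \<le> k \<Longrightarrow> power_limit n (e (- of_int k))" for k
  proof (induction "nat (k + q)" arbitrary: k rule: less_induct)
    case less
    show ?case
    proof (cases "k < int n - q")
      case True
      then have "power_limit n (e (of_int (- k)))"
        using less.prems q by (intro right) auto
      then show ?thesis
        by simp
    next
      case False
      then have k: "int n - q \<le> k" "k \<le> 2 * q"
        using less.prems by auto
      have "power_limit n (\<lambda>h. \<Sum>i\<le>m k. a k i * e (- b k i) h)"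
      proof -
        have "(\<Sum>i\<le>m k. a k i * poly (P h) (- b k i)) = 0" for h
          using annih [OF k, of "pcompose (P h) [:0, -1:]"] deg [of h]
          by (simp add: poly_pcompose degree_pcompose)
        then show ?thesis
          using power_limit_reflect [OF lim [OF k]]
          by (simp add: e_def right_diff_distrib sum_subtractf)
      qed
      then show ?thesis
      proof (rule power_limit_at_node [OF diff [OF k] node [OF k], where e = "\<lambda>x. e (- x)"])
        fix z
        assume "z \<in> nodes (m k) (b k) - {of_int k}"
        then obtain l where "z = of_int l" "- q \<le> l" "l \<le> k - 1"
          using others [OF k] by auto
        then show "power_limit n (e (- z))"
          using less by auto
      qed
    qed
  qed
  have "power_limit n (e (of_int j))"
  proof (cases "- q \<le> j")
    case True
    then show ?thesis
      using j by (intro right)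
  next
    case False
    then show ?thesis
      using left [of "- j"] j by (simp add: q_def)
  qed
  then show ?thesis
    by (simp add: e_def [abs_def])
qed

text \<open>
  The theorem for a function whose Taylor polynomial of degree below \<open>n\<close> vanishes, with the two
  parities treated at once.
\<close>

lemma power_limit_of_differences:
  fixes n :: nat and g :: "real \<Rightarrow> real"
    and m :: "int \<Rightarrow> nat" and a b :: "int \<Rightarrow> nat \<Rightarrow> real"
  defines "q \<equiv> int (n div 2)"
  assumes "n \<ge> 2"
    and small: "((\<lambda>h. g h / h ^ (n - 1)) \<longlongrightarrow> 0) (at 0)" and g0: "g 0 = 0"
    and diff: "\<And>k. int n - q \<le> k \<Longrightarrow> k \<le> 2 * q \<Longrightarrow> is_difference (m k) (a k) (b k)"
    and annih: "\<And>k Q. int n - q \<le> k \<Longrightarrow> k \<le> 2 * q \<Longrightarrow> degree Q < n \<Longrightarrow>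
                  (\<Sum>i\<le>m k. a k i * poly Q (b k i)) = 0"
    and node: "\<And>k. int n - q \<le> k \<Longrightarrow> k \<le> 2 * q \<Longrightarrow> of_int k \<in> nodes (m k) (b k)"
    and others: "\<And>k. int n - q \<le> k \<Longrightarrow> k \<le> 2 * q \<Longrightarrow>
                   nodes (m k) (b k) - {of_int k} \<subseteq> of_int ` {- q..k - 1}"
    and lim: "\<And>k. int n - q \<le> k \<Longrightarrow> k \<le> 2 * q \<Longrightarrow>
                power_limit n (\<lambda>h. \<Sum>i\<le>m k. a k i * g (b k i * h))"
  shows "power_limit n g"
proof -
  have q: "int n - q - 1 \<le> q" "q \<ge> 1"
    using \<open>n \<ge> 2\<close> by (auto simp: q_def)
  define K :: "real set" where "K = of_int ` {- q..<int n - q}"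
  have K: "finite K" "card K = n"
    by (simp_all add: K_def card_image inj_on_def)
  have "K \<noteq> {}"
    using K(2) \<open>n \<ge> 2\<close> by auto
  define P where "P h = lagrange_interpolant K (\<lambda>x. g (x * h))" for h
  have degP: "degree (P h) < n" for h
    using degree_lagrange_interpolant [OF K(1) \<open>K \<noteq> {}\<close>] K(2) by (simp add: P_def)
  have polyP: "poly (P h) z = g (z * h)" if "z \<in> K" for h z
    using that K(1) by (simp add: P_def poly_lagrange_interpolant)
  have err: "power_limit n (\<lambda>h. g (of_int j * h) - poly (P h) (of_int j))"
    if "- 2 * q \<le> j" "j \<le> 2 * q" for j
    by (rule interpolation_error_power_limit [where m = m and a = a and b = b])
       (use that degP diff annih node others lim in \<open>auto simp: q_def K_def intro!: polyP\<close>)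
  have coeffP: "power_limit n (\<lambda>h. coeff (P h) j)" if "j < n" for j
  proof (rule power_limit_of_dilation [OF that])
    have "((\<lambda>h. g (x * h) / h ^ (n - 1)) \<longlongrightarrow> 0) (at 0)" for x
      using tendsto_scaled_quotient [OF small, of x] g0 by (cases "x = 0") auto
    then have "((\<lambda>h. \<Sum>x\<in>K. g (x * h) / h ^ (n - 1) * coeff (lagrange_basis K x) j) \<longlongrightarrow>
        (\<Sum>x\<in>K. 0 * coeff (lagrange_basis K x) j)) (at 0)"
      by (intro tendsto_intros)
    then show "((\<lambda>h. coeff (P h) j / h ^ (n - 1)) \<longlongrightarrow> 0) (at 0)"
      by (simp add: P_def lagrange_interpolant_def coeff_sum sum_divide_distrib)
  next
    have eq: "coeff (P (2 * h)) j - 2 ^ j * coeff (P h) j =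
        (\<Sum>x\<in>K. coeff (lagrange_basis K x) j * (g (2 * x * h) - poly (P h) (2 * x)))" for h
    proof -
      define Q where "Q = P (2 * h) - pcompose (P h) [:0, 2:]"
      have "degree Q < card K"
        unfolding Q_def using degP by (intro degree_diff_less) (auto simp: K degree_pcompose)
      then have "Q = lagrange_interpolant K (poly Q)"
        by (rule lagrange_interpolant_unique [OF K(1)])
      then have "coeff Q j = (\<Sum>x\<in>K. poly Q x * coeff (lagrange_basis K x) j)"
        by (metis (no_types, lifting) lagrange_interpolant_def coeff_sum coeff_smult sum.cong)
      moreover have "poly Q x = g (2 * x * h) - poly (P h) (2 * x)" if "x \<in> K" for x
        using that by (simp add: Q_def polyP poly_pcompose mult_ac)
      ultimately show ?thesis
        by (simp add: Q_def coeff_pcompose_linear mult.commute)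
    qed
    have "power_limit n (\<lambda>h. g (2 * x * h) - poly (P h) (2 * x))" if "x \<in> K" for x
    proof -
      from that obtain l where l: "x = of_int l" "- q \<le> l" "l < int n - q"
        by (auto simp: K_def)
      then show ?thesis
        using err [of "2 * l"] q by simp
    qed
    then show "power_limit n (\<lambda>h. coeff (P (2 * h)) j - 2 ^ j * coeff (P h) j)"
      unfolding eq by (intro power_limit_sum power_limit_cmult)
  qed
  have "poly (P h) 1 = (\<Sum>j<n. coeff (P h) j)" for h
  proof -
    have "poly (P h) 1 = (\<Sum>j\<le>degree (P h). coeff (P h) j)"
      by (simp add: poly_altdef)
    also have "\<dots> = (\<Sum>j<n. coeff (P h) j)"
      using degP [of h] by (intro sum.mono_neutral_left) (auto simp: coeff_eq_0)
    finally show ?thesis .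
  qed
  moreover have "power_limit n (\<lambda>h. (\<Sum>j<n. coeff (P h) j) + (g (1 * h) - poly (P h) 1))"
    using err [of 1] q by (intro power_limit_add power_limit_sum coeffP) auto
  ultimately show ?thesis
    by simp
qed

section \<open>Reduction to a vanishing Taylor polynomial\<close>

lemma peano_differentiable_remainder:
  assumes "peano_differentiable (n - 1) f c" "n \<ge> 1"
  obtains T where "degree T < n"
    and "((\<lambda>h. (f (c + h) - poly T h) / h ^ (n - 1)) \<longlongrightarrow> 0) (at 0)"
proof -
  from assms(1) obtain p
    where p: "((\<lambda>h. (f (c + h) - poly p (c + h)) / h ^ (n - 1)) \<longlongrightarrow> 0) (at 0)"
    unfolding peano_differentiable_def by auto
  define r where "r = pcompose p [:c, 1:]"
  define T S where "T = r mod monom 1 n" and "S = r div monom 1 n"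
  have "poly p (c + h) = poly (monom 1 n * S + T) h" for h
    by (simp add: S_def T_def r_def poly_pcompose)
  then have pT: "poly p (c + h) = h ^ n * poly S h + poly T h" for h
    by (simp add: poly_monom)
  have "((\<lambda>h. (f (c + h) - poly p (c + h)) / h ^ (n - 1) + h * poly S h) \<longlongrightarrow> 0 + 0 * poly S 0) (at 0)"
    by (intro tendsto_intros p)
  moreover have "(f (c + h) - poly p (c + h)) / h ^ (n - 1) + h * poly S h
      = (f (c + h) - poly T h) / h ^ (n - 1)" if "h \<noteq> 0" for h
    using that assms(2) unfolding pT by (cases n) (auto simp: field_simps)
  ultimately have "((\<lambda>h. (f (c + h) - poly T h) / h ^ (n - 1)) \<longlongrightarrow> 0) (at 0)"
    by (auto elim!: Lim_transform_eventually simp: eventually_at_filter)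
  moreover have "degree T < n"
    using degree_mod_less [of "monom 1 n" r] assms(2)
    by (auto simp: T_def monom_eq_0_iff degree_monom_eq)
  ultimately show ?thesis
    using that by blast
qed

lemma peano_differentiable_of_power_limit:
  assumes "power_limit n (\<lambda>h. f (c + h) - poly T h)"
  shows "peano_differentiable n f c"
proof -
  from assms obtain L where L: "((\<lambda>h. (f (c + h) - poly T h) / h ^ n) \<longlongrightarrow> L) (at 0)"
    unfolding power_limit_def by auto
  define p where "p = pcompose (T + monom L n) [:- c, 1:]"
  have p: "poly p (c + h) = poly T h + L * h ^ n" for h
    by (simp add: p_def poly_pcompose poly_monom)
  have "((\<lambda>h. (f (c + h) - poly T h) / h ^ n - L) \<longlongrightarrow> L - L) (at 0)"
    by (intro tendsto_intros L)
  moreover have "(f (c + h) - poly T h) / h ^ n - L = (f (c + h) - poly p (c + h)) / h ^ n"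
    if "h \<noteq> 0" for h
    using that by (simp add: p field_simps)
  ultimately have "((\<lambda>h. (f (c + h) - poly p (c + h)) / h ^ n) \<longlongrightarrow> 0) (at 0)"
    by (auto elim!: Lim_transform_eventually simp: eventually_at_filter)
  then show ?thesis
    unfolding peano_differentiable_def by blast
qed

text \<open>
  The order is defined through the powers of \<open>x\<close> at the centre \<open>c\<close>; translation to the origin
  gives the independence of \<open>c\<close>.
\<close>

lemma has_order_annihilates:
  assumes "has_order m a b c p" "degree Q < p"
  shows "(\<Sum>i\<le>m. a i * poly Q (b i)) = 0"
proof -
  define R where "R = pcompose Q [:- c, 1:]"
  have degR: "degree R < p"
    using assms(2) by (simp add: R_def degree_pcompose)
  have "poly Q (b i) = (\<Sum>j\<le>degree R. coeff R j * (c + b i) ^ j)" for i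
    by (simp add: R_def poly_pcompose flip: poly_altdef)
  then have "(\<Sum>i\<le>m. a i * poly Q (b i))
      = (\<Sum>i\<le>m. \<Sum>j\<le>degree R. coeff R j * (a i * (c + b i) ^ j))"
    by (simp add: sum_distrib_left mult_ac)
  also have "\<dots> = (\<Sum>j\<le>degree R. coeff R j * (\<Sum>i\<le>m. a i * (c + b i) ^ j))"
    by (subst sum.swap) (simp add: sum_distrib_left)
  also have "\<dots> = 0"
    using assms(1) degR by (intro sum.neutral) (auto simp: has_order_def difference_def)
  finally show ?thesis .
qed

text \<open>
  The value of \<open>g\<close> at zero is not controlled by \<open>g h = o(h ^ r)\<close>. If zero is a node
  with non-zero coefficient, the existence of the limit forces \<open>g 0 = 0\<close>; otherwise that value
  does not enter. In both cases it may be replaced by zero.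
\<close>

lemma power_limit_redefine_at_0:
  fixes a b :: "nat \<Rightarrow> real"
  assumes small: "((\<lambda>h. g h / h ^ r) \<longlongrightarrow> 0) (at 0)" and "n \<ge> 1"
    and lim: "power_limit n (\<lambda>h. \<Sum>i\<le>m. a i * g (b i * h))"
  shows "power_limit n (\<lambda>h. \<Sum>i\<le>m. a i * (g(0 := 0)) (b i * h))"
proof -
  define g' where "g' = g(0 := 0)"
  define A where "A = (\<Sum>i\<le>m. if b i = 0 then a i else 0)"
  have split: "(\<Sum>i\<le>m. a i * g (b i * h)) = (\<Sum>i\<le>m. a i * g' (b i * h)) + A * g 0"
    if "h \<noteq> 0" for h
    unfolding A_def sum_distrib_right sum.distrib [symmetric]
    by (rule sum.cong) (use that in \<open>auto simp: g'_def\<close>)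
  have "((\<lambda>h. g h / h ^ r * h ^ r) \<longlongrightarrow> 0 * 0 ^ r) (at 0)"
    by (intro tendsto_intros small)
  then have "(g \<longlongrightarrow> 0) (at 0)"
    by (auto elim!: Lim_transform_eventually simp: eventually_at_filter)
  then have g'0: "(g' \<longlongrightarrow> 0) (at 0)"
    by (rule Lim_transform_eventually) (auto simp: eventually_at_filter g'_def)
  have "((\<lambda>h. g' (x * h)) \<longlongrightarrow> 0) (at 0)" for x
    using filterlim_compose [OF g'0 filterlim_times_at_0, of x] by (cases "x = 0") (auto simp: g'_def)
  then have "((\<lambda>h. (\<Sum>i\<le>m. a i * g' (b i * h)) + A * g 0) \<longlongrightarrow> (\<Sum>i\<le>m. a i * 0) + A * g 0) (at 0)"
    by (intro tendsto_intros)
  then have lim1: "((\<lambda>h. \<Sum>i\<le>m. a i * g (b i * h)) \<longlongrightarrow> A * g 0) (at 0)"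
    by (auto elim!: Lim_transform_eventually simp: eventually_at_filter split)
  from lim obtain L where L: "((\<lambda>h. (\<Sum>i\<le>m. a i * g (b i * h)) / h ^ n) \<longlongrightarrow> L) (at 0)"
    unfolding power_limit_def by auto
  have "((\<lambda>h. (\<Sum>i\<le>m. a i * g (b i * h)) / h ^ n * h ^ n) \<longlongrightarrow> L * 0 ^ n) (at 0)"
    by (intro tendsto_intros L)
  then have "((\<lambda>h. \<Sum>i\<le>m. a i * g (b i * h)) \<longlongrightarrow> L * 0 ^ n) (at 0)"
    by (rule Lim_transform_eventually) (auto simp: eventually_at_filter)
  then have "A * g 0 = 0"
    using tendsto_unique [OF _ lim1] \<open>n \<ge> 1\<close> by auto
  then have "((\<lambda>h. (\<Sum>i\<le>m. a i * g' (b i * h)) / h ^ n) \<longlongrightarrow> L) (at 0)"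
    using L by (auto elim!: Lim_transform_eventually simp: eventually_at_filter split)
  then show ?thesis
    unfolding power_limit_def g'_def by blast
qed

text \<open>
  Both parities in one formulation: for odd \<open>n\<close> the range of \<open>k\<close> is \<open>(n + 1) / 2, \<dots>, n - 1\<close>,
  for even \<open>n\<close> it is \<open>n / 2, \<dots>, n\<close>.
\<close>

lemma peano_differentiable_of_differences:
  fixes n :: nat and c :: real and f :: "real \<Rightarrow> real"
    and m :: "int \<Rightarrow> nat" and a b :: "int \<Rightarrow> nat \<Rightarrow> real"
  defines "q \<equiv> int (n div 2)"
  assumes "n \<ge> 2" and peano: "peano_differentiable (n - 1) f c"
    and D: "\<And>k. int n - q \<le> k \<Longrightarrow> k \<le> 2 * q \<Longrightarrow>
         is_difference (m k) (a k) (b k) \<and>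
         (\<exists>p\<ge>n. has_order (m k) (a k) (b k) c p) \<and>
         of_int k \<in> nodes (m k) (b k) \<and>
         nodes (m k) (b k) - {of_int k} \<subseteq> of_int ` {- q..k - 1} \<and>
         (\<exists>L::real. ((\<lambda>h. difference (m k) (a k) (b k) c h f / h ^ n) \<longlongrightarrow> L) (at 0))"
  shows "peano_differentiable n f c"
proof -
  obtain T where T: "degree T < n"
    and small: "((\<lambda>h. (f (c + h) - poly T h) / h ^ (n - 1)) \<longlongrightarrow> 0) (at 0)"
    using peano_differentiable_remainder [OF peano] \<open>n \<ge> 2\<close> by auto
  define g where "g h = f (c + h) - poly T h" for h
  have small_g: "((\<lambda>h. g h / h ^ (n - 1)) \<longlongrightarrow> 0) (at 0)"
    using small by (simp add: g_def)
  have annih: "(\<Sum>i\<le>m k. a k i * poly Q (b k i)) = 0"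
    if "int n - q \<le> k" "k \<le> 2 * q" "degree Q < n" for k Q
    using D [OF that(1,2)] has_order_annihilates that(3) by (meson less_le_trans)
  have lim: "power_limit n (\<lambda>h. \<Sum>i\<le>m k. a k i * g (b k i * h))"
    if k: "int n - q \<le> k" "k \<le> 2 * q" for k
  proof -
    have "(\<Sum>i\<le>m k. a k i * poly T (b k i * h)) = 0" for h
    proof -
      have "degree (pcompose T [:0, h:]) < n"
        using T by (simp add: degree_pcompose)
      from annih [OF k this] show ?thesis
        by (simp add: poly_pcompose mult.commute)
    qed
    then have "difference (m k) (a k) (b k) c h f = (\<Sum>i\<le>m k. a k i * g (b k i * h))" for h
      by (simp add: difference_def g_def right_diff_distrib sum_subtractf)
    then show ?thesis
      using D [OF k] by (simp add: power_limit_def)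
  qed
  have "power_limit n (g(0 := 0))"
  proof (rule power_limit_of_differences [OF \<open>n \<ge> 2\<close>, where m = m and a = a and b = b, folded q_def])
    show "((\<lambda>h. (g(0 := 0)) h / h ^ (n - 1)) \<longlongrightarrow> 0) (at 0)"
      by (rule Lim_transform_eventually [OF small_g]) (auto simp: eventually_at_filter)
    show "power_limit n (\<lambda>h. \<Sum>i\<le>m k. a k i * (g(0 := 0)) (b k i * h))"
      if "int n - q \<le> k" "k \<le> 2 * q" for k
      using power_limit_redefine_at_0 [OF small_g _ lim [OF that]] \<open>n \<ge> 2\<close> by auto
  qed (use D annih in auto)
  then obtain L where L: "((\<lambda>h. (g(0 := 0)) h / h ^ n) \<longlongrightarrow> L) (at 0)"
    unfolding power_limit_def by blast
  have "((\<lambda>h. g h / h ^ n) \<longlongrightarrow> L) (at 0)"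
    by (rule Lim_transform_eventually [OF L]) (auto simp: eventually_at_filter)
  then have "power_limit n g"
    unfolding power_limit_def by blast
  then show ?thesis
    unfolding g_def by (rule peano_differentiable_of_power_limit)
qed

theorem theorem0p1:
  fixes n :: nat and c :: real and f :: "real \<Rightarrow> real"
    and m :: "int \<Rightarrow> nat" and a b :: "int \<Rightarrow> nat \<Rightarrow> real"
  assumes "n \<ge> 2"
    and "peano_differentiable (n - 1) f c"
  shows
    "(odd n \<and>
      (\<forall>k::int. (int n + 1) div 2 \<le> k \<and> k \<le> int n - 1 \<longrightarrow>
         is_difference (m k) (a k) (b k) \<and>
         (\<exists>p\<ge>n. has_order (m k) (a k) (b k) c p) \<and>
         of_int k \<in> nodes (m k) (b k) \<and>
         nodes (m k) (b k) - {of_int k} \<subseteq> of_int ` {- ((int n - 1) div 2)..k - 1} \<and>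
         (\<exists>L::real. ((\<lambda>h. difference (m k) (a k) (b k) c h f / h ^ n) \<longlongrightarrow> L) (at 0)))
      \<longrightarrow> peano_differentiable n f c) \<and>
     (even n \<and>
      (\<forall>k::int. int n div 2 \<le> k \<and> k \<le> int n \<longrightarrow>
         is_difference (m k) (a k) (b k) \<and>
         (\<exists>p\<ge>n. has_order (m k) (a k) (b k) c p) \<and>
         of_int k \<in> nodes (m k) (b k) \<and>
         nodes (m k) (b k) - {of_int k} \<subseteq> of_int ` {- (int n div 2)..k - 1} \<and>
         (\<exists>L::real. ((\<lambda>h. difference (m k) (a k) (b k) c h f / h ^ n) \<longlongrightarrow> L) (at 0)))
      \<longrightarrow> peano_differentiable n f c)"
proof (intro conjI impI; elim conjE)
  assume "odd n"
  then have eqs: "(int n + 1) div 2 = int n - int (n div 2)" "int n - 1 = 2 * int (n div 2)"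
    "2 * int (n div 2) div 2 = int (n div 2)"
    by (auto elim!: oddE)
  assume *: "\<forall>k::int. (int n + 1) div 2 \<le> k \<and> k \<le> int n - 1 \<longrightarrow>
         is_difference (m k) (a k) (b k) \<and>
         (\<exists>p\<ge>n. has_order (m k) (a k) (b k) c p) \<and>
         of_int k \<in> nodes (m k) (b k) \<and>
         nodes (m k) (b k) - {of_int k} \<subseteq> of_int ` {- ((int n - 1) div 2)..k - 1} \<and>
         (\<exists>L::real. ((\<lambda>h. difference (m k) (a k) (b k) c h f / h ^ n) \<longlongrightarrow> L) (at 0))"
  show "peano_differentiable n f c"
    by (rule peano_differentiable_of_differences [OF assms, of m a b], rule * [rule_format, unfolded eqs])
       (rule conjI)
next
  assume "even n"
  then have eqs: "int n div 2 = int (n div 2)" "int n - int (n div 2) = int (n div 2)"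
    "2 * int (n div 2) = int n"
    by (auto elim!: evenE)
  assume *: "\<forall>k::int. int n div 2 \<le> k \<and> k \<le> int n \<longrightarrow>
         is_difference (m k) (a k) (b k) \<and>
         (\<exists>p\<ge>n. has_order (m k) (a k) (b k) c p) \<and>
         of_int k \<in> nodes (m k) (b k) \<and>
         nodes (m k) (b k) - {of_int k} \<subseteq> of_int ` {- (int n div 2)..k - 1} \<and>
         (\<exists>L::real. ((\<lambda>h. difference (m k) (a k) (b k) c h f / h ^ n) \<longlongrightarrow> L) (at 0))"
  show "peano_differentiable n f c"
    by (rule peano_differentiable_of_differences [OF assms, of m a b], unfold eqs(2,3),
        rule * [rule_format, unfolded eqs(1)]) (rule conjI)
qed

end
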